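(* For every integer $m\ge2$, $E^{*}_{2m}\in B\,\mathbb{Q}_{+}[B,C]$; that is, there is a polynomial $P(x,y)$ all of whose coefficients are positive rational numbers such that $E^{*}_{2m}=B\cdot P(B,C)$ as functions on $\mathbb{H}$, where $B=E_4^*$ and $C=E_6^*/E_4^*$.
   Context: $\mathbb{H}$ is the upper half-plane and $q=e^{2\pi i\tau}$. Bernoulli numbers: $\frac{x}{e^x-1}=\sum_{n\ge0}\frac{B_n}{n!}x^n$. For $n,s\ge1$, $\sigma^{*}_{s}(n)=-\sum_{d\mid n}(-1)^{d}d^{s}$. For $k\ge1$, $E^{*}_{2k}(\tau)=1-\frac{1}{1-2^{2k}}\cdot\frac{4k}{B_{2k}}\sum_{n\ge1}\sigma^{*}_{2k-1}(n)q^{n}$. $\mathbb{Q}_{+}[B,C]$ denotes the set of polynomials in $B,C$ with all coefficients positive rational numbers. *)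

theory Defs
  imports
    "HOL-Analysis.Analysis"
    "HOL-Computational_Algebra.Computational_Algebra"
begin

definition bernoulli :: "nat \<Rightarrow> rat" where
  "bernoulli n = fact n * fps_nth (fps_X / (fps_exp 1 - 1)) n"

(* Division of formal power series is total; this confirms that the quotient above
   is the genuine one. *)
lemma bernoulli_generating_function:
  "Abs_fps (\<lambda>n. bernoulli n / fact n) * (fps_exp 1 - 1) = fps_X"
proof -
  have sd: "subdegree (fps_exp (1::rat) - 1) = 1"
    by (intro subdegreeI) auto
  have nz: "fps_exp (1::rat) - 1 \<noteq> 0"
    using sd by force
  have dv: "(fps_exp (1::rat) - 1) dvd fps_X"
    using sd nz by (subst fps_dvd_iff) auto
  have "Abs_fps (\<lambda>n. bernoulli n / fact n) = fps_X / (fps_exp 1 - 1)"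
    by (rule fps_ext) (simp add: bernoulli_def)
  then show ?thesis
    using dv by simp
qed

definition sigma_star :: "nat \<Rightarrow> nat \<Rightarrow> int" where
  "sigma_star s n = - (\<Sum>d | d dvd n. (-1) ^ d * int d ^ s)"

definition upper_half_plane :: "complex set" where
  "upper_half_plane = {\<tau>. Im \<tau> > 0}"

definition q_param :: "complex \<Rightarrow> complex" where
  "q_param \<tau> = exp (2 * of_real pi * \<i> * \<tau>)"

(* The first argument is half the weight: E_star k is the series of weight 2k. *)
definition E_star :: "nat \<Rightarrow> complex \<Rightarrow> complex" where
  "E_star k \<tau> =
     1 - 1 / (1 - 2 ^ (2 * k)) * (4 * of_nat k / of_rat (bernoulli (2 * k)))
         * (\<Sum>n. of_int (sigma_star (2 * k - 1) (Suc n)) * q_param \<tau> ^ Suc n)"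

definition B_form :: "complex \<Rightarrow> complex" where
  "B_form \<tau> = E_star 2 \<tau>"

definition C_form :: "complex \<Rightarrow> complex" where
  "C_form \<tau> = E_star 3 \<tau> / E_star 2 \<tau>"

(* A polynomial in x and y is an element of Q[y][x]: coeff (coeff P i) j is the
   coefficient of x^i y^j. *)
definition eval2 :: "rat poly poly \<Rightarrow> complex \<Rightarrow> complex \<Rightarrow> complex" where
  "eval2 P x y = poly (poly (map_poly (map_poly of_rat) P) [:x:]) y"

(* The coefficients of P are those of the monomials that occur in P. *)
definition positive_coeffs :: "rat poly poly \<Rightarrow> bool" where
  "positive_coeffs P \<longleftrightarrow>
     (\<forall>i j. coeff (coeff P i) j \<noteq> 0 \<longrightarrow> coeff (coeff P i) j > 0)"

end

theory Submission
  imports Defs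
begin

text \<open>
  With \<open>g(X) = X e\<^sup>t / (1 + X e\<^sup>t)\<^sup>2\<close>, the even Taylor coefficients in \<open>t\<close> of the sum of \<open>g(q\<^sup>m)\<close> over
  all integers \<open>m\<close> are rational multiples of the \<open>E*\<^sub>2\<^sub>k\<close>; up to scaling and an additive constant this
  sum is the Weierstrass function shifted by a half period. Its differential equation is obtained by
  Eisenstein's method. Each summand satisfies \<open>g'' = g - 6 g\<^sup>2\<close>, and for \<open>m \<noteq> n\<close> the product
  \<open>g(q\<^sup>m) g(q\<^sup>n)\<close> splits by partial fractions into a linear part and a part that telescopes when summed
  with \<open>n - m\<close> fixed. Hence, apart from the constant term, \<open>f'' = c f - 6 f\<^sup>2\<close> for some number \<open>c\<close>.
  After the sign change \<open>a\<^sub>j = (-1)\<^sup>j f\<^sub>2\<^sub>j\<close> the recurrence for the coefficients reads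
  \<open>(2j+2)(2j+1) a\<^sub>j\<^sub>+\<^sub>1 = L a\<^sub>j + 6 (a\<^sub>1 a\<^sub>j\<^sub>-\<^sub>1 + \<dots> + a\<^sub>j\<^sub>-\<^sub>1 a\<^sub>1)\<close>. Its case \<open>j = 1\<close> shows that \<open>L\<close> is a positive
  multiple of \<open>C\<close>, so positivity follows by induction. The same recurrence at \<open>q = 0\<close> gives the sign
  of the Bernoulli numbers relating \<open>a\<^sub>j\<close> to \<open>E*\<^sub>2\<^sub>j\<^sub>+\<^sub>2\<close>.
\<close>

section \<open>The generating series of one summand\<close>

text \<open>The expansion in t of 1/(1 + X e^t). It is an antiderivative of \<open>- gfps X\<close>
  and carries the telescoping part of the products.\<close>

definition hfps :: "'a::field_char_0 \<Rightarrow> 'a fps" where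
  "hfps X = inverse (1 + fps_const X * fps_exp 1)"

text \<open>Equivalently \<open>X e\<^sup>t / (1 + X e\<^sup>t)\<^sup>2\<close>. At \<open>X = -1\<close> the inverse in \<open>hfps\<close> is the junk value \<open>0\<close>.\<close>
definition gfps :: "'a::field_char_0 \<Rightarrow> 'a fps" where
  "gfps X = hfps X * (1 - hfps X)"

lemma hfps_mult:
  assumes "X \<noteq> -1"
  shows "hfps X * (1 + fps_const X * fps_exp 1) = 1"
  unfolding hfps_def
proof (rule inverse_mult_eq_1)
  show "(1 + fps_const X * fps_exp 1) $ 0 \<noteq> 0"
    using assms by (simp add: add_eq_0_iff)
qed

lemma hfps_unique:
  assumes "X \<noteq> -1" "f * (1 + fps_const X * fps_exp 1) = 1"
  shows "f = hfps X"
  using assms(2) hfps_mult[OF assms(1)] by (metis mult.assoc mult.commute mult_1)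

text \<open>Differentiating h (1 + E) = 1, where E' = E, gives h' (1 + E) = - h E; multiply by h and
  use h E = 1 - h.\<close>

lemma hfps_deriv:
  assumes "X \<noteq> -1"
  shows "fps_deriv (hfps X) = - gfps X"
proof -
  define E where "E = fps_const X * fps_exp 1"
  have h: "hfps X * (1 + E) = 1"
    unfolding E_def by (rule hfps_mult[OF assms])
  have "fps_deriv (hfps X * (1 + E)) = 0"
    by (simp add: h)
  moreover have "fps_deriv (1 + E) = E"
    by (simp add: E_def)
  ultimately have *: "fps_deriv (hfps X) * (1 + E) + hfps X * E = 0"
    by (simp add: algebra_simps)
  show ?thesis
    unfolding gfps_def using * h by algebra
qed

text \<open>From h' = -g and g = h (1 - h) follows g' = (2h - 1) g. One more derivative gives (2h -
  1)^2 g - 2 g^2, and (2h - 1)^2 = 1 - 4g.\<close>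

lemma gfps_deriv2:
  assumes "X \<noteq> -1"
  shows "fps_deriv (fps_deriv (gfps X)) = gfps X - 6 * gfps X ^ 2"
proof -
  have 1: "fps_deriv (gfps X) = 2 * hfps X * gfps X - gfps X"
    unfolding gfps_def by (simp add: hfps_deriv[OF assms] gfps_def algebra_simps)
  have "fps_deriv (fps_deriv (gfps X)) = (2 * hfps X - 1) ^ 2 * gfps X - 2 * gfps X ^ 2"
    unfolding 1 by (simp add: 1 hfps_deriv[OF assms] power2_eq_square algebra_simps)
  also have "(2 * hfps X - 1) ^ 2 = 1 - 4 * gfps X"
    by (simp add: gfps_def power2_eq_square algebra_simps)
  finally show ?thesis
    by (simp add: power2_eq_square algebra_simps)
qed

lemma hfps_nth_Suc:
  assumes "X \<noteq> -1"
  shows "hfps X $ Suc k = - gfps X $ k / of_nat (Suc k)"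
proof -
  have "of_nat (Suc k) * hfps X $ Suc k = - gfps X $ k"
    using arg_cong[OF hfps_deriv[OF assms], of "\<lambda>f. f $ k"] by simp
  thus ?thesis
    by (simp add: field_simps del: of_nat_Suc)
qed

lemma gfps_rec:
  assumes "X \<noteq> -1"
  shows "of_nat ((k + 2) * (k + 1)) * gfps X $ (k + 2) = gfps X $ k - 6 * (gfps X ^ 2) $ k"
proof -
  have "fps_deriv (fps_deriv (gfps X)) $ k = gfps X $ k - 6 * (gfps X ^ 2) $ k"
    by (subst gfps_deriv2[OF assms]) (simp add: numeral_fps_const)
  thus ?thesis
    by (simp add: algebra_simps numeral_2_eq_2)
qed

text \<open>Partial fractions: for h = 1/(1 + E) and k = 1/(1 + r E) one has h k (1 - r) = h - r k.
  Replacing h k repeatedly in h (1 - h) k (1 - k) leaves a combination of the two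
  \<open>gfps\<close> and a multiple of the difference k - h.\<close>

lemma gfps_mult:
  assumes "X \<noteq> -1" "Y \<noteq> -1" "Y = r * X" "r \<noteq> 1"
  shows "gfps X * gfps Y = fps_const (- r / (1 - r)\<^sup>2) * (gfps X + gfps Y)
           + fps_const (r * (1 + r) / (1 - r) ^ 3) * (hfps Y - hfps X)"
proof -
  define h k E R s where "h = hfps X" "k = hfps Y" "E = fps_const X * fps_exp 1"
    "R = fps_const r" "s = fps_const (1 / (1 - r))"
  note defs = this
  have rE: "fps_const Y * fps_exp 1 = R * E"
    by (simp add: defs assms(3) mult.assoc flip: fps_const_mult)
  have h: "h * (1 + E) = 1"
    using hfps_mult[OF assms(1)] by (simp add: defs)
  have k: "k * (1 + R * E) = 1"
    using hfps_mult[OF assms(2)] rE by (simp add: defs(2))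
  have s: "s * (1 - R) = 1"
    using assms(4) by (simp add: defs flip: fps_const_1_eq_1 fps_const_sub)
  have hk: "h * k * (1 - R) = h - R * k"
    using h k by algebra
  have p: "h * k = s * (h - R * k)"
    using hk s by algebra
  have a: "fps_const (- r / (1 - r)\<^sup>2) = - R * s\<^sup>2"
    by (simp add: defs power2_eq_square)
  have b: "fps_const (r * (1 + r) / (1 - r) ^ 3) = R * (1 + R) * s ^ 3"
    by (simp add: defs power3_eq_cube flip: fps_const_1_eq_1)
  have "h * (1 - h) * (k * (1 - k)) = - R * s\<^sup>2 * (h * (1 - h) + k * (1 - k)) + R * (1 + R) * s ^ 3 * (k - h)"
    using p s by algebra
  thus ?thesis
    unfolding gfps_def a b by (simp add: defs)
qed

text \<open>The reflection t -> -t: 1/(1 + X e^(-t)) and 1/(1 + X^(-1) e^t) add up to 1, and h (1 -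
  h) is invariant under h -> 1 - h.\<close>

lemma gfps_inverse:
  assumes "X \<noteq> -1" "X \<noteq> 0"
  shows "gfps (inverse X) $ k = (-1) ^ k * gfps X $ k"
proof -
  have X': "inverse X \<noteq> -1"
    using assms by (metis inverse_inverse_eq inverse_minus_eq inverse_1)
  define f where "f = hfps X oo (fps_const (-1) * fps_X)"
  have "(hfps X * (1 + fps_const X * fps_exp 1)) oo (fps_const (-1) * fps_X) = 1"
    by (simp add: hfps_mult[OF assms(1)])
  hence f: "f * (1 + fps_const X * fps_exp (-1)) = 1"
    by (simp add: f_def fps_compose_mult_distrib fps_compose_add_distrib del: fps_const_neg)
  have e: "fps_exp (-1) * fps_exp (1::'a) = 1"
    by (simp flip: fps_exp_add_mult)
  have c: "fps_const X * fps_const (inverse X) = 1"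
    using assms by simp
  have "(1 - f) * (1 + fps_const (inverse X) * fps_exp 1) = 1"
    using f e c by algebra
  from hfps_unique[OF X' this] have h: "hfps (inverse X) = 1 - f" ..
  have "gfps (inverse X) = gfps X oo (fps_const (-1) * fps_X)"
    by (simp add: gfps_def h f_def fps_compose_mult_distrib fps_compose_sub_distrib del: fps_const_neg)
  thus ?thesis
    by (simp add: fps_compose_linear)
qed

section \<open>Values at X = 1 and Bernoulli numbers\<close>

text \<open>Compare coefficients in t/(e^t - 1) - 2t/(e^(2t) - 1) = t/(e^t + 1); the second
  fraction, \<open>b2\<close>, is the first at 2t, hence the power of 2.\<close>

lemma hfps_1_bernoulli: "hfps 1 $ n = (1 - 2 ^ Suc n) * bernoulli (Suc n) / fact (Suc n)"
proof -
  define b where "b = Abs_fps (\<lambda>n. bernoulli n / fact n)"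
  define e where "e = fps_exp (1::rat)"
  define b2 where "b2 = b oo (fps_const 2 * fps_X)"
  have b: "b * (e - 1) = fps_X"
    unfolding b_def e_def by (rule bernoulli_generating_function)
  have e2: "fps_exp (2::rat) = e * e"
    by (simp add: e_def flip: fps_exp_add_mult)
  have "(b * (e - 1)) oo (fps_const 2 * fps_X) = fps_const 2 * fps_X"
    by (simp add: b)
  hence b2: "b2 * (e * e - 1) = 2 * fps_X"
    by (simp add: b2_def e_def fps_compose_mult_distrib fps_compose_sub_distrib numeral_fps_const
        flip: e2[unfolded e_def])
  have e1: "e - 1 \<noteq> 0"
    using b by auto
  have "(b - b2) * (1 + e) * (e - 1) = fps_X * (e - 1)"
  proof -
    have "(b - b2) * (1 + e) * (e - 1) = b * (e - 1) * (1 + e) - b2 * (e * e - 1)"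
      by (simp add: algebra_simps)
    also have "\<dots> = fps_X * (1 + e) - 2 * fps_X"
      unfolding b b2 ..
    finally show ?thesis
      by (simp add: algebra_simps)
  qed
  hence be: "(b - b2) * (1 + e) = fps_X"
    using e1 by simp
  have h: "hfps 1 * (1 + e) = 1"
    using hfps_mult[of "1::rat"] by (simp add: e_def)
  have "b - b2 = fps_X * hfps 1"
  proof -
    have "b - b2 = (b - b2) * (hfps 1 * (1 + e))"
      by (simp only: h mult_1_right)
    also have "\<dots> = (b - b2) * (1 + e) * hfps 1"
      by (simp only: mult_ac)
    finally show ?thesis
      by (simp only: be)
  qed
  hence "(b - b2) $ Suc n = hfps 1 $ n"
    by simp
  thus ?thesis
    unfolding b2_def fps_compose_linear
    by (simp add: b_def diff_divide_distrib left_diff_distrib del: fact_Suc)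
qed

lemma gfps_1_bernoulli:
  "gfps 1 $ (2 * j) = (2 ^ (2 * Suc j) - 1) * bernoulli (2 * Suc j) / (of_nat (2 * Suc j) * fact (2 * j))"
proof -
  have "gfps 1 $ (2 * j) = - of_nat (Suc (2 * j)) * hfps (1::rat) $ Suc (2 * j)"
    by (subst hfps_nth_Suc) (auto simp del: of_nat_Suc)
  also have "\<dots> = - of_nat (Suc (2 * j)) * ((1 - 2 ^ (2 * Suc j)) * bernoulli (2 * Suc j) / fact (Suc (Suc (2 * j))))"
    by (subst hfps_1_bernoulli) simp
  also have "\<dots> = (2 ^ (2 * Suc j) - 1) * bernoulli (2 * Suc j) / (of_nat (2 * Suc j) * fact (2 * j))"
  proof -
    have "fact (Suc (Suc (2 * j))) = of_nat (2 * Suc j) * of_nat (Suc (2 * j)) * (fact (2 * j) :: rat)"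
      by (simp only: fact_Suc) (simp add: algebra_simps)
    moreover have "of_nat (Suc (2 * j)) \<noteq> (0::rat)"
      by (rule of_nat_neq_0)
    ultimately show ?thesis
      by (simp add: divide_simps del: of_nat_Suc fact_Suc) (simp add: algebra_simps)
  qed
  finally show ?thesis .
qed

text \<open>The equation defining \<open>hfps 1\<close> has rational coefficients, so by uniqueness
  its solution is the image of the rational one. This lets signs be discussed over
  \<open>rat\<close>.\<close>

lemma gfps_1_of_rat: "(gfps 1 :: 'a::field_char_0 fps) $ k = of_rat (gfps 1 $ k)"
proof -
  define f :: "'a fps" where "f = Abs_fps (\<lambda>n. of_rat (hfps 1 $ n))"
  have one: "of_rat ((1::rat fps) $ n) = (1::'a fps) $ n" for n
    by simp
  have fct: "of_rat (fact n) = (fact n :: 'a)" for n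
    by (metis of_nat_fact of_rat_of_nat_eq)
  have "f * (1 + fps_const 1 * fps_exp 1) = 1"
  proof (rule fps_ext)
    fix n
    have "(f * (1 + fps_const 1 * fps_exp 1)) $ n = of_rat ((hfps 1 * (1 + fps_const 1 * fps_exp 1)) $ n)"
      by (simp add: fps_mult_nth f_def of_rat_sum of_rat_mult of_rat_add of_rat_divide fct algebra_simps)
    also have "\<dots> = (1::'a fps) $ n"
      by (subst hfps_mult) (auto simp: one)
    finally show "(f * (1 + fps_const 1 * fps_exp 1)) $ n = (1::'a fps) $ n" .
  qed
  from hfps_unique[OF _ this] have "hfps 1 = f" by simp
  thus ?thesis
    by (simp add: gfps_def fps_mult_nth f_def of_rat_sum of_rat_mult of_rat_diff
        if_distrib[of of_rat] cong: if_cong)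
qed

section \<open>Convergence\<close>

lemma summable_nat_power_mult_power:
  fixes z :: "'a::{real_normed_field,banach}"
  assumes "norm z < 1"
  shows "summable (\<lambda>d. of_nat d ^ k * z ^ d)"
  using assms
proof (induction k arbitrary: z)
  case 0
  thus ?case by (simp add: summable_geometric)
next
  case (Suc k)
  have "summable (\<lambda>d. diffs (\<lambda>d. of_nat d ^ k) d * z ^ d)"
    using Suc.prems Suc.IH by (rule termdiff_converges)
  hence "summable (\<lambda>d. z * (diffs (\<lambda>d. of_nat d ^ k) d * z ^ d))"
    by (rule summable_mult)
  also have "(\<lambda>d. z * (diffs (\<lambda>d. of_nat d ^ k) d * z ^ d)) = (\<lambda>d. of_nat (Suc d) ^ Suc k * z ^ Suc d)"
    by (simp add: diffs_def fun_eq_iff algebra_simps)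
  finally show ?case
    by (subst (asm) summable_Suc_iff)
qed

text \<open>Formally 1/(1 + X e^t) is the sum of (-X)^d e^(d t). The coefficientwise sums are shown
  to satisfy the equation that characterises \<open>hfps X\<close>.\<close>

lemma hfps_nth_sums:
  fixes X :: complex
  assumes "norm X < 1"
  shows "(\<lambda>d. (-1) ^ d * of_nat d ^ k / fact k * X ^ d) sums (hfps X $ k)"
proof -
  define t where "t = (\<lambda>k d. (-1) ^ d * of_nat d ^ k / fact k * X ^ d)"
  have summ: "summable (t k)" for k
  proof -
    have "summable (\<lambda>d. of_nat d ^ k * (- X) ^ d)"
      using assms by (intro summable_nat_power_mult_power) auto
    hence "summable (\<lambda>d. 1 / fact k * (of_nat d ^ k * (- X) ^ d))"
      by (rule summable_mult)
    thus ?thesis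
      by (simp add: t_def power_minus[of X] mult_ac)
  qed
  define f where "f = Abs_fps (\<lambda>k. suminf (t k))"
  have X: "X \<noteq> -1"
    using assms by auto
  have "f * (1 + fps_const X * fps_exp 1) = 1"
  proof (rule fps_ext)
    fix k
    \<comment> \<open>By the binomial theorem, multiplication by e^t turns d into d + 1. A further
      factor -X then shifts the series \<open>t k\<close> by one place, so in the product only
      \<open>t k 0\<close> survives.\<close>
    have binom: "(\<Sum>i=0..k. t i d / fact (k - i)) = (-1) ^ d * of_nat (Suc d) ^ k / fact k * X ^ d" for d
    proof -
      have "of_nat (Suc d) ^ k / fact k = (of_nat d + 1 :: complex) ^ k / fact k"
        by (simp add: add.commute)
      also have "\<dots> = (\<Sum>i=0..k. of_nat d ^ i / (fact i * fact (k - i)))"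
        by (subst binomial_ring) (auto simp: sum_divide_distrib binomial_fact atLeast0AtMost intro!: sum.cong)
      finally have "(-1) ^ d * X ^ d * (of_nat (Suc d) ^ k / fact k) =
          (-1) ^ d * X ^ d * (\<Sum>i=0..k. of_nat d ^ i / (fact i * fact (k - i)))"
        by (simp only:)
      thus ?thesis
        by (simp add: t_def sum_distrib_left mult_ac)
    qed
    have "(\<lambda>d. \<Sum>i=0..k. t i d / fact (k - i)) sums (\<Sum>i=0..k. suminf (t i) / fact (k - i))"
      by (intro sums_sum sums_divide summable_sums summ)
    hence "(\<lambda>d. - X * (\<Sum>i=0..k. t i d / fact (k - i))) sums (- X * (\<Sum>i=0..k. suminf (t i) / fact (k - i)))"
      by (rule sums_mult)
    also have "(\<lambda>d. - X * (\<Sum>i=0..k. t i d / fact (k - i))) = (\<lambda>d. t k (Suc d))"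
      unfolding binom by (simp add: t_def fun_eq_iff)
    finally have "t k sums (- X * (\<Sum>i=0..k. suminf (t i) / fact (k - i)) + t k 0)"
      by (subst (asm) sums_Suc_iff)
    hence *: "suminf (t k) = - X * (\<Sum>i=0..k. suminf (t i) / fact (k - i)) + t k 0"
      by (simp add: sums_iff)
    have "(f * (1 + fps_const X * fps_exp 1)) $ k = suminf (t k) + X * (\<Sum>i=0..k. suminf (t i) / fact (k - i))"
    proof -
      have "f * (1 + fps_const X * fps_exp 1) = f + fps_const X * (f * fps_exp 1)"
        by (simp add: algebra_simps)
      thus ?thesis
        by (simp add: f_def fps_mult_nth[of _ "fps_exp 1"])
    qed
    also have "\<dots> = t k 0"
      by (subst *) simp
    \<comment> \<open>Since \<open>0 ^ 0 = 1\<close>, the term \<open>t k 0\<close> is 1 for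
      \<open>k = 0\<close> and 0 otherwise.\<close>
    finally show "(f * (1 + fps_const X * fps_exp 1)) $ k = 1 $ k"
      by (cases k) (simp_all add: t_def)
  qed
  from hfps_unique[OF X this] have "hfps X $ k = suminf (t k)"
    by (metis f_def fps_nth_Abs_fps)
  with summ[of k] show ?thesis
    by (simp add: t_def summable_sums)
qed

text \<open>Termwise from \<open>hfps_nth_sums\<close> at \<open>Suc k\<close>. The term at d = 0
  vanishes, so the sum runs over positive d, with the summands of \<open>sigma_star\<close>.\<close>

lemma gfps_nth_sums:
  fixes X :: complex
  assumes "norm X < 1"
  shows "(\<lambda>d. - ((-1) ^ Suc d * of_nat (Suc d) ^ Suc k) / fact k * X ^ Suc d) sums (gfps X $ k)"
proof -
  have X: "X \<noteq> -1"
    using assms by auto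
  have "(\<lambda>d. - of_nat (Suc k) * ((-1) ^ d * of_nat d ^ Suc k / fact (Suc k) * X ^ d)) sums
      (- of_nat (Suc k) * hfps X $ Suc k)"
    by (intro sums_mult hfps_nth_sums assms)
  also have "- of_nat (Suc k) * hfps X $ Suc k = gfps X $ k"
    by (subst hfps_nth_Suc[OF X]) (simp del: of_nat_Suc)
  also have "(\<lambda>d. - of_nat (Suc k) * ((-1) ^ d * of_nat d ^ Suc k / fact (Suc k) * X ^ d)) =
      (\<lambda>d. - ((-1) ^ d * of_nat d ^ Suc k) / fact k * X ^ d)"
  proof
    fix d
    have "of_nat (Suc k) \<noteq> (0::complex)"
      by (rule of_nat_neq_0)
    thus "- of_nat (Suc k) * ((-1) ^ d * of_nat d ^ Suc k / fact (Suc k) * X ^ d) =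
        - ((-1) ^ d * of_nat d ^ Suc k) / fact k * X ^ d"
      by (simp add: fact_Suc divide_simps del: of_nat_Suc power_Suc)
  qed
  finally have "(\<lambda>d. - ((-1) ^ d * of_nat d ^ Suc k) / fact k * X ^ d) sums (gfps X $ k)" .
  thus ?thesis
    by (subst sums_Suc_iff) simp
qed

text \<open>Each term of the series has a factor X; what remains is bounded termwise with r in place
  of \<open>norm X\<close>. The linear bound allows comparison with a geometric series in powers of
  q.\<close>

lemma gfps_nth_bound:
  assumes "0 \<le> r" "r < 1"
  obtains M where "M \<ge> 0" "\<And>X::complex. norm X \<le> r \<Longrightarrow> norm (gfps X $ k) \<le> M * norm X"
proof -
  define s where "s = (\<lambda>d. real (Suc d) ^ Suc k / fact k * r ^ d)"
  have "summable (\<lambda>d. real d ^ Suc k * r ^ d)"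
    using assms by (intro summable_nat_power_mult_power) auto
  hence "summable (\<lambda>d. real (Suc d) ^ Suc k * r ^ Suc d)"
    by (subst summable_Suc_iff)
  have s: "summable s"
  \<comment> \<open>The known series carries \<open>r ^ Suc d\<close>. One factor is divided out if
    r is nonzero; for \<open>r = 0\<close> only the term d = 0 is left.\<close>
  proof (cases "r = 0")
    case True
    have "summable (\<lambda>d. real (Suc d) ^ Suc k / fact k * 0 ^ d)"
      by (rule summable_finite[of "{0}"]) auto
    thus ?thesis
      by (simp add: s_def True)
  next
    case False
    have "summable (\<lambda>d. inverse (r * fact k) * (real (Suc d) ^ Suc k * r ^ Suc d))"
      by (intro summable_mult) fact
    also have "(\<lambda>d. inverse (r * fact k) * (real (Suc d) ^ Suc k * r ^ Suc d)) = s"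
      using False by (simp add: s_def fun_eq_iff field_simps)
    finally show ?thesis .
  qed
  have "norm (gfps X $ k) \<le> suminf s * norm X" if X: "norm X \<le> r" for X :: complex
  proof -
    have X1: "norm X < 1"
      using X assms by simp
    have "(\<lambda>d. s d * norm X) sums (suminf s * norm X)"
      by (intro sums_mult2 summable_sums s)
    moreover have "norm (- ((-1) ^ Suc d * of_nat (Suc d) ^ Suc k) / fact k * X ^ Suc d) \<le> s d * norm X" for d
    proof -
      have "norm (- ((-1) ^ Suc d * of_nat (Suc d) ^ Suc k) / fact k * X ^ Suc d) =
          real (Suc d) ^ Suc k / fact k * norm X ^ d * norm X"
        by (simp add: norm_mult norm_divide norm_power del: of_nat_Suc)
      also have "\<dots> \<le> real (Suc d) ^ Suc k / fact k * r ^ d * norm X"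
        using X by (intro mult_right_mono mult_left_mono power_mono) auto
      finally show ?thesis
        by (simp add: s_def)
    qed
    ultimately show ?thesis
      using gfps_nth_sums[OF X1, of k] by (metis (no_types, lifting) norm_suminf_le sums_iff)
  qed
  moreover have "suminf s \<ge> 0"
    using s assms by (intro suminf_nonneg) (auto simp: s_def)
  ultimately show ?thesis
    using that by blast
qed

section \<open>Unordered sums over the integers and over products\<close>

lemma summable_on_power_abs_int:
  fixes r :: real
  assumes "0 \<le> r" "r < 1"
  shows "(\<lambda>m::int. r ^ nat \<bar>m\<bar>) summable_on UNIV"
proof -
  have geo: "(\<lambda>n::nat. r ^ n) summable_on UNIV"
    using assms by (subst summable_on_UNIV_nonneg_real_iff) (auto simp: summable_geometric)
  have "(\<lambda>m::int. r ^ nat \<bar>m\<bar>) summable_on {0..}"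
    using geo by (subst summable_on_reindex_bij_witness[where T = UNIV and i = int and j = nat]) auto
  moreover have "(\<lambda>m::int. r ^ nat \<bar>m\<bar>) summable_on {..0}"
    using geo
    by (subst summable_on_reindex_bij_witness[where T = UNIV and i = "\<lambda>n. - int n" and j = "\<lambda>m. nat (- m)"]) auto
  ultimately have "(\<lambda>m::int. r ^ nat \<bar>m\<bar>) summable_on {0..} \<union> {..0}"
    by (rule summable_on_union)
  moreover have "{0..} \<union> {..0} = (UNIV :: int set)"
    by auto
  ultimately show ?thesis by simp
qed

lemma has_sum_product:
  fixes a :: "'b \<Rightarrow> complex" and b :: "'c \<Rightarrow> complex"
  assumes "a summable_on A" "b summable_on B"
  shows "((\<lambda>(x, y). a x * b y) has_sum (infsum a A * infsum b B)) (A \<times> B)"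
proof (rule has_sum_SigmaI)
  show "((\<lambda>y. case (x, y) of (x, y) \<Rightarrow> a x * b y) has_sum (a x * infsum b B)) B" for x
    using assms by (auto intro: has_sum_cmult_right)
  show "((\<lambda>x. a x * infsum b B) has_sum (infsum a A * infsum b B)) A"
    using assms by (auto intro: has_sum_cmult_left)
  have "(\<lambda>z. norm ((\<lambda>(x, y). a x * b y) z)) summable_on A \<times> B"
    unfolding Infinite_Sum.abs_summable_on_Sigma_iff
  proof (intro conjI ballI)
    have b: "(\<lambda>y. norm (b y)) summable_on B"
      using assms by (simp flip: summable_on_iff_abs_summable_on_complex)
    have a: "(\<lambda>x. norm (a x)) summable_on A"
      using assms by (simp flip: summable_on_iff_abs_summable_on_complex)
    show "(\<lambda>y. norm (case (x, y) of (x, y) \<Rightarrow> a x * b y)) summable_on B" for x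
      using summable_on_cmult_right[OF b, of "norm (a x)"] by (simp add: norm_mult)
    have "(\<lambda>x. norm (a x) * (\<Sum>\<^sub>\<infinity>y\<in>B. norm (b y))) summable_on A"
      using a by (rule summable_on_cmult_left)
    thus "(\<lambda>x. norm (\<Sum>\<^sub>\<infinity>y\<in>B. norm (case (x, y) of (x, y) \<Rightarrow> a x * b y))) summable_on A"
      by (simp add: norm_mult infsum_cmult_right' infsum_nonneg abs_mult)
  qed
  thus "(\<lambda>(x, y). a x * b y) summable_on A \<times> B"
    by (rule abs_summable_summable)
qed

lemma has_sum_sum_finite:
  fixes f :: "'i \<Rightarrow> 'b \<Rightarrow> 'a::topological_comm_monoid_add"
  assumes "\<And>i. i \<in> I \<Longrightarrow> (f i has_sum s i) A"
  shows "((\<lambda>x. \<Sum>i\<in>I. f i x) has_sum (\<Sum>i\<in>I. s i)) A"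
  using assms by (induction I rule: infinite_finite_induct) (auto intro!: has_sum_add)

section \<open>The sum over all integers\<close>

text \<open>The sum of power series in t is taken one coefficient at a time. For 0 < |q| < 1 it
  converges by \<open>gfps_power_int_summable\<close>.\<close>

definition lattice_sum :: "complex \<Rightarrow> nat \<Rightarrow> complex" where
  "lattice_sum q k = (\<Sum>\<^sub>\<infinity>m::int. gfps (q powi m) $ k)"

context
  fixes q :: complex
  assumes q0: "q \<noteq> 0" and q1: "norm q < 1"
begin

text \<open>Taken at z = -1 it keeps every summand away from the junk value of \<open>hfps\<close>;
  at z = 1 it keeps \<open>1 - q powi j\<close> from vanishing.\<close>

lemma power_int_neq:
  assumes "m \<noteq> 0" "norm z = 1"
  shows "q powi m \<noteq> z"
proof -
  have "norm q powi m \<noteq> 1"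
  proof (cases "m > 0")
    case True
    hence "norm q powi m = norm q ^ nat m"
      by (simp add: power_int_def)
    thus ?thesis
      using True q1 power_Suc_less_one[of "norm q" "nat m - 1"] q0 by simp
  next
    case False
    hence "norm q powi m = inverse (norm q ^ nat (- m))"
      using assms by (simp add: power_int_def power_inverse)
    moreover have "norm q ^ nat (- m) < 1"
      using False assms q1 power_Suc_less_one[of "norm q" "nat (-m) - 1"] q0 by simp
    ultimately show ?thesis
      by (metis inverse_1 inverse_inverse_eq less_irrefl)
  qed
  thus ?thesis
    using assms(2) by (metis norm_power_int)
qed

lemma power_int_neq_minus_1: "q powi m \<noteq> -1"
  using power_int_neq[of m "-1"] by (cases "m = 0") auto

lemma gfps_power_int_minus: "gfps (q powi (- m)) $ k = (-1) ^ k * gfps (q powi m) $ k"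
  using gfps_inverse[OF power_int_neq_minus_1[of m]] q0 by (simp add: power_int_minus)

lemma gfps_power_int_summable: "(\<lambda>m::int. gfps (q powi m) $ k) summable_on UNIV"
proof -
  obtain M where M: "M \<ge> 0" "\<And>X::complex. norm X \<le> norm q \<Longrightarrow> norm (gfps X $ k) \<le> M * norm X"
    using gfps_nth_bound[of "norm q" k] q1 by auto
  \<comment> \<open>The bound \<open>M\<close> covers positive m only; the maximum includes m = 0,
    and negative m follow by reflection.\<close>
  define N where "N = max M (norm (gfps (1::complex) $ k))"
  have pos: "norm (gfps (q ^ n) $ k) \<le> N * norm q ^ n" for n
  proof (cases n)
    case 0
    thus ?thesis by (simp add: N_def)
  next
    case (Suc n')
    have "norm (q ^ n) \<le> norm q"
      using q1 Suc mult_left_mono[of "norm q ^ n'" 1 "norm q"] by (simp add: norm_mult norm_power power_le_one)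
    from M(2)[OF this] have "norm (gfps (q ^ n) $ k) \<le> M * norm q ^ n"
      by (simp add: norm_power)
    also have "\<dots> \<le> N * norm q ^ n"
      by (intro mult_right_mono) (auto simp: N_def)
    finally show ?thesis .
  qed
  have bound: "norm (gfps (q powi m) $ k) \<le> N * norm q ^ nat \<bar>m\<bar>" for m
  proof (cases "m \<ge> 0")
    case True
    thus ?thesis
      using pos[of "nat m"] by (simp add: power_int_def)
  next
    case False
    hence "q powi (- m) = q ^ nat (- m)"
      by (simp add: power_int_def)
    hence "norm (gfps (q powi m) $ k) = norm (gfps (q ^ nat (-m)) $ k)"
      using gfps_power_int_minus[of m k] by (simp add: norm_mult norm_power)
    thus ?thesis
      using pos[of "nat (- m)"] False by simp
  qed
  have "(\<lambda>m::int. N * norm q ^ nat \<bar>m\<bar>) summable_on UNIV"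
    by (rule summable_on_cmult_right[OF summable_on_power_abs_int]) (use q1 in auto)
  from Infinite_Sum.abs_summable_on_comparison_test'[OF this bound] show ?thesis
    by (rule abs_summable_summable)
qed

lemma lattice_sum_odd:
  assumes "odd k"
  shows "lattice_sum q k = 0"
proof -
  have "lattice_sum q k = (\<Sum>\<^sub>\<infinity>m::int. gfps (q powi (- m)) $ k)"
    unfolding lattice_sum_def
    by (rule infsum_reindex_bij_witness[where i = uminus and j = uminus]) auto
  also have "\<dots> = - lattice_sum q k"
    using assms by (simp add: gfps_power_int_minus infsum_uminus lattice_sum_def)
  finally show ?thesis by simp
qed

lemma lattice_sum_mult_has_sum:
  "((\<lambda>(m, n). (gfps (q powi m) * gfps (q powi n)) $ k) has_sum
     (\<Sum>i=0..k. lattice_sum q i * lattice_sum q (k - i))) UNIV"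
proof -
  have "((\<lambda>x. \<Sum>i=0..k. (\<lambda>(m, n). gfps (q powi m) $ i * gfps (q powi n) $ (k - i)) x) has_sum
     (\<Sum>i=0..k. lattice_sum q i * lattice_sum q (k - i))) (UNIV \<times> UNIV)"
    unfolding lattice_sum_def
    by (intro has_sum_sum_finite has_sum_product gfps_power_int_summable)
  thus ?thesis
    by (simp add: fps_mult_nth case_prod_unfold)
qed

text \<open>\<open>gfps_mult\<close> with r = \<open>q powi j\<close>. By translation invariance
  both linear terms have the same sum. For \<open>k \<ge> 1\<close> the coefficient of
  \<open>hfps\<close> is a multiple of the previous one of \<open>gfps\<close>, hence summable, so
  the difference of its two translates sums to 0.\<close>

lemma gfps_mult_shift_has_sum:
  assumes "j \<noteq> 0" "k \<ge> 1"
  shows "((\<lambda>m. (gfps (q powi m) * gfps (q powi (m + j))) $ k) has_sum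
           (- (q powi j) / (1 - q powi j)\<^sup>2 * (2 * lattice_sum q k))) UNIV"
proof -
  define a where "a = - (q powi j) / (1 - q powi j)\<^sup>2"
  define b where "b = q powi j * (1 + q powi j) / (1 - q powi j) ^ 3"
  obtain k' where k: "k = Suc k'"
    using assms(2) by (cases k) auto
  have G: "((\<lambda>m. gfps (q powi m) $ i) has_sum lattice_sum q i) UNIV" for i
    unfolding lattice_sum_def using gfps_power_int_summable by auto
  have bij: "bij_betw (\<lambda>m. m + j) UNIV UNIV"
    by (rule bij_betwI[of _ _ _ "\<lambda>m. m - j"]) auto
  have shift: "((\<lambda>m. f (m + j)) has_sum s) UNIV" if "(f has_sum s) UNIV" for f :: "int \<Rightarrow> complex" and s
    using has_sum_reindex_bij_betw[OF bij, of f s] that by simp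
  have H: "((\<lambda>m. hfps (q powi m) $ k) has_sum (- lattice_sum q k' / of_nat (Suc k'))) UNIV"
    unfolding k hfps_nth_Suc[OF power_int_neq_minus_1]
    using has_sum_divide_const[OF has_sum_uminusI[OF G[of k']], of "of_nat (Suc k')"]
    by (simp del: of_nat_Suc)
  have "((\<lambda>m. a * (gfps (q powi m) $ k + gfps (q powi (m + j)) $ k) +
          b * (hfps (q powi (m + j)) $ k + - (hfps (q powi m) $ k))) has_sum
         (a * (lattice_sum q k + lattice_sum q k) +
          b * (- lattice_sum q k' / of_nat (Suc k') + - (- lattice_sum q k' / of_nat (Suc k'))))) UNIV"
    by (intro has_sum_add has_sum_cmult_right has_sum_uminusI G H
          shift[of "\<lambda>m. gfps (q powi m) $ k"] shift[of "\<lambda>m. hfps (q powi m) $ k"])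
  also have "(\<lambda>m. a * (gfps (q powi m) $ k + gfps (q powi (m + j)) $ k) +
          b * (hfps (q powi (m + j)) $ k + - (hfps (q powi m) $ k))) =
       (\<lambda>m. (gfps (q powi m) * gfps (q powi (m + j))) $ k)"
  proof
    fix m
    have "q powi (m + j) = q powi j * q powi m"
      using q0 by (simp add: power_int_add)
    moreover have "q powi j \<noteq> 1"
      by (rule power_int_neq[OF assms(1)]) simp
    ultimately have "gfps (q powi m) * gfps (q powi (m + j)) =
        fps_const a * (gfps (q powi m) + gfps (q powi (m + j))) +
        fps_const b * (hfps (q powi (m + j)) - hfps (q powi m))"
      unfolding a_def b_def by (intro gfps_mult power_int_neq_minus_1)
    thus "a * (gfps (q powi m) $ k + gfps (q powi (m + j)) $ k) +
          b * (hfps (q powi (m + j)) $ k + - (hfps (q powi m) $ k)) =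
       (gfps (q powi m) * gfps (q powi (m + j))) $ k"
      by simp
  qed
  finally show ?thesis
    by (simp add: a_def)
qed

text \<open>For \<open>k = 0\<close> the telescoping sum of the \<open>hfps\<close> does not vanish, hence the restriction to \<open>k \<ge> 1\<close>.\<close>
lemma lattice_sum_rec:
  obtains c where "\<And>k. k \<ge> 1 \<Longrightarrow> of_nat ((k + 2) * (k + 1)) * lattice_sum q (k + 2) =
    c * lattice_sum q k - 6 * (\<Sum>i=0..k. lattice_sum q i * lattice_sum q (k - i))"
proof -
  \<comment> \<open>The linear parts summed over all differences j; what matters is that
    \<open>c\<close> does not depend on k.\<close>
  define c where "c = (\<Sum>\<^sub>\<infinity>j\<in>-{0::int}. - (q powi j) / (1 - q powi j)\<^sup>2) * 2"
  have "of_nat ((k + 2) * (k + 1)) * lattice_sum q (k + 2) =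
      (1 + 6 * c) * lattice_sum q k - 6 * (\<Sum>i=0..k. lattice_sum q i * lattice_sum q (k - i))"
    if k: "k \<ge> 1" for k
  proof -
    define T where "T = (\<lambda>(m, n). (gfps (q powi m) * gfps (q powi n)) $ k)"
    define S where "S = (\<Sum>i=0..k. lattice_sum q i * lattice_sum q (k - i))"
    have T: "(T has_sum S) UNIV"
      unfolding T_def S_def by (rule lattice_sum_mult_has_sum)
    \<comment> \<open>The diagonal carries the squares from the differential equation of a summand.
      The pairs off it are grouped by \<open>j = n - m\<close>, one telescoping sum for each
      j.\<close>
    define D :: "(int \<times> int) set" where "D = {(m, n). m = n}"
    have TA: "T summable_on A" for A
      by (rule summable_on_subset_banach[OF has_sum_imp_summable[OF T]]) simp
    have diag: "infsum T D = (\<Sum>\<^sub>\<infinity>m. (gfps (q powi m) ^ 2) $ k)"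
      by (rule infsum_reindex_bij_witness[where i = "\<lambda>m. (m, m)" and j = fst])
         (auto simp: D_def T_def power2_eq_square)
    have "infsum T (-D) = (\<Sum>\<^sub>\<infinity>(j, m)\<in>(-{0}) \<times> UNIV. (gfps (q powi m) * gfps (q powi (m + j))) $ k)"
      by (rule infsum_reindex_bij_witness[where i = "\<lambda>(j, m). (m, m + j)" and j = "\<lambda>(m, n). (n - m, m)"])
         (auto simp: D_def T_def)
    also have "\<dots> = (\<Sum>\<^sub>\<infinity>j\<in>-{0}. \<Sum>\<^sub>\<infinity>m. (gfps (q powi m) * gfps (q powi (m + j))) $ k)"
    proof (subst infsum_Sigma_banach[symmetric])
      show "(\<lambda>(j, m). (gfps (q powi m) * gfps (q powi (m + j))) $ k) summable_on (-{0}) \<times> UNIV"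
        using TA[of "-D"]
        by (subst summable_on_reindex_bij_witness[where j = "\<lambda>(j, m). (m, m + j)" and i = "\<lambda>(m, n). (n - m, m)" and T = "-D" and h = T])
           (auto simp: D_def T_def)
    qed simp
    also have "\<dots> = (\<Sum>\<^sub>\<infinity>j\<in>-{0::int}. - (q powi j) / (1 - q powi j)\<^sup>2 * (2 * lattice_sum q k))"
      by (rule infsum_cong, rule infsumI, rule gfps_mult_shift_has_sum) (use k in auto)
    also have "\<dots> = c * lattice_sum q k"
      \<comment> \<open>The primed rule also holds when an infinite sum has its default value 0, so
        it applies whatever the convergence of the series in \<open>c\<close>.\<close>
      by (subst infsum_cmult_left') (simp add: c_def)
    finally have off: "infsum T (-D) = c * lattice_sum q k" .
    have "S = infsum T (D \<union> -D)"
      using T by (simp add: infsumI)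
    also have "\<dots> = infsum T D + infsum T (-D)"
      by (intro infsum_Un_disjoint TA) auto
    finally have D: "infsum T D = S - c * lattice_sum q k"
      by (simp add: off)
    have Dsum: "((\<lambda>m. (gfps (q powi m) ^ 2) $ k) has_sum infsum T D) UNIV"
    proof -
      have "(\<lambda>m. (gfps (q powi m) ^ 2) $ k) summable_on UNIV"
        using TA[of D]
        by (subst summable_on_reindex_bij_witness[where j = "\<lambda>m. (m, m)" and i = fst and T = D and h = T])
           (auto simp: D_def T_def power2_eq_square)
      thus ?thesis
        by (simp add: diag)
    qed
    have G: "((\<lambda>m. gfps (q powi m) $ i) has_sum lattice_sum q i) UNIV" for i
      unfolding lattice_sum_def using gfps_power_int_summable by auto
    have "((\<lambda>m. of_nat ((k + 2) * (k + 1)) * gfps (q powi m) $ (k + 2)) has_sum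
        (of_nat ((k + 2) * (k + 1)) * lattice_sum q (k + 2))) UNIV"
      by (intro has_sum_cmult_right G)
    moreover have "((\<lambda>m. gfps (q powi m) $ k + - (6 * (gfps (q powi m) ^ 2) $ k)) has_sum
        (lattice_sum q k + - (6 * infsum T D))) UNIV"
      by (intro has_sum_add has_sum_uminusI has_sum_cmult_right G Dsum)
    ultimately have "of_nat ((k + 2) * (k + 1)) * lattice_sum q (k + 2) = lattice_sum q k + - (6 * infsum T D)"
      unfolding gfps_rec[OF power_int_neq_minus_1] diff_conv_add_uminus by (rule has_sum_unique)
    thus ?thesis
      unfolding D S_def[symmetric] by (simp add: algebra_simps)
  qed
  thus ?thesis
    by (rule that)
qed

section \<open>The q-expansion\<close>

text \<open>A Lambert series: expand each summand in powers of q and collect the terms of the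
  absolutely convergent double series with equal product \<open>Suc m * Suc d\<close>.\<close>

lemma gfps_power_suminf_sigma_star:
  "((\<lambda>m::nat. gfps (q ^ Suc m) $ k) has_sum
     ((\<Sum>n. of_int (sigma_star (Suc k) (Suc n)) * q ^ Suc n) / fact k)) UNIV"
proof -
  define T :: "nat \<times> nat \<Rightarrow> complex"
    where "T = (\<lambda>(m, d). - ((-1) ^ Suc d * of_nat (Suc d) ^ Suc k) / fact k * q ^ (Suc m * Suc d))"
  define U where "U = (\<lambda>(n, d). - ((-1) ^ d * of_nat d ^ Suc k) / fact k * q ^ Suc n)"
  have Tsum: "(\<lambda>z. norm (T z)) summable_on UNIV"
  proof (rule Infinite_Sum.abs_summable_on_comparison_test)
    define a where "a = (\<lambda>m. complex_of_real (norm q) ^ m)"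
    \<comment> \<open>Since \<open>Suc m * Suc d \<ge> m + d\<close>, the double series is dominated
      by a product of two single ones. Dividing by \<open>norm q\<close> leaves the power
      \<open>norm q ^ d\<close>.\<close>
    define b where "b = (\<lambda>d. complex_of_real (real (Suc d) ^ Suc k * norm q ^ Suc d / (norm q * fact k)))"
    have a: "a summable_on UNIV"
      unfolding a_def using q1
      by (intro norm_summable_imp_summable_on) (simp add: norm_power summable_geometric)
    have "summable (\<lambda>d. real d ^ Suc k * norm q ^ d)"
      using q1 by (intro summable_nat_power_mult_power) auto
    hence "summable (\<lambda>d. real (Suc d) ^ Suc k * norm q ^ Suc d / (norm q * fact k))"
      by (intro summable_divide) (subst summable_Suc_iff)
    hence b: "b summable_on UNIV"
      unfolding b_def
      by (intro norm_summable_imp_summable_on) (simp add: norm_mult norm_power norm_divide del: of_nat_Suc)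
    have "(\<lambda>z. norm ((\<lambda>(m, d). a m * b d) z)) summable_on UNIV"
      using has_sum_imp_summable[OF has_sum_product[OF a b]]
      by (subst summable_on_iff_abs_summable_on_complex[symmetric]) simp
    thus "(\<lambda>z. norm (case z of (m, d) \<Rightarrow> a m * b d)) summable_on UNIV"
      by simp
    fix z :: "nat \<times> nat"
    obtain m d where z: "z = (m, d)"
      by (cases z)
    have "norm (T z) = real (Suc d) ^ Suc k / fact k * norm q ^ (Suc m * Suc d)"
      by (simp add: T_def z norm_mult norm_power norm_divide del: of_nat_Suc power_Suc mult_Suc mult_Suc_right)
    also have "\<dots> \<le> real (Suc d) ^ Suc k / fact k * norm q ^ (m + d)"
      using q1 by (intro mult_left_mono power_decreasing) auto
    also have "\<dots> = norm (a m * b d)"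
      using q0 by (simp add: a_def b_def norm_mult norm_power norm_divide power_add del: of_nat_Suc)
    finally show "norm (T z) \<le> norm (case z of (m, d) \<Rightarrow> a m * b d)"
      by (simp add: z)
  qed
  define s where "s = infsum T UNIV"
  have T: "(T has_sum s) (UNIV \<times> UNIV)"
    using abs_summable_summable[OF Tsum] by (simp add: s_def)
  have 1: "((\<lambda>m. gfps (q ^ Suc m) $ k) has_sum s) UNIV"
  proof (rule has_sum_SigmaD[OF T])
    fix m :: nat
    have "norm (q ^ Suc m) < 1"
      unfolding norm_power using q0 q1 by (intro power_Suc_less_one) auto
    from gfps_nth_sums[OF this, of k] have "(\<lambda>d. T (m, d)) sums (gfps (q ^ Suc m) $ k)"
      by (simp add: T_def flip: power_mult del: power_Suc mult_Suc mult_Suc_right of_nat_Suc)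
    moreover have "summable (\<lambda>d. norm (T (m, d)))"
    proof -
      have "(\<lambda>z. norm (T z)) summable_on (Pair m ` UNIV)"
        using Tsum by (rule summable_on_subset_banach) auto
      hence "(\<lambda>d. norm (T (m, d))) summable_on UNIV"
        by (subst (asm) summable_on_reindex) (auto simp: o_def inj_on_def)
      thus ?thesis
        by (rule summable_on_imp_summable)
    qed
    ultimately show "((\<lambda>d. T (m, d)) has_sum (gfps (q ^ Suc m) $ k)) UNIV"
      by (intro norm_summable_imp_has_sum)
  qed
  have "(U has_sum s) (Sigma UNIV (\<lambda>n. {d. d dvd Suc n}))"
  proof -
    \<comment> \<open>In \<open>T\<close> both indices start at 0 and stand for the factors
      \<open>Suc m\<close> and \<open>Suc d\<close>; in \<open>U\<close> the exponent is
      \<open>Suc n\<close>, but d is the divisor itself.\<close>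
    have "(T has_sum s) (UNIV \<times> UNIV) \<longleftrightarrow> (U has_sum s) (Sigma UNIV (\<lambda>n. {d. d dvd Suc n}))"
    proof (rule has_sum_reindex_bij_witness[where j = "\<lambda>(m, d). (Suc m * Suc d - 1, Suc d)"
             and i = "\<lambda>(n, d). (Suc n div d - 1, d - 1)"])
      fix z :: "nat \<times> nat" assume "z \<in> Sigma UNIV (\<lambda>n. {d. d dvd Suc n})"
      then obtain n d e where z: "z = (n, d)" "Suc n = d * e"
        by (auto simp: dvd_def)
      from z(2) have de: "d > 0" "e > 0"
        by (auto intro!: Nat.gr0I)
      have "Suc n div d = e"
        using de by (simp add: z(2))
      moreover have "Suc (e - 1) * Suc (d - 1) - 1 = n"
        using de by (simp add: mult.commute[of e] z(2)[symmetric] del: mult_Suc mult_Suc_right)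
      ultimately show "(\<lambda>(m, d). (Suc m * Suc d - 1, Suc d)) ((\<lambda>(n, d). (Suc n div d - 1, d - 1)) z) = z"
        unfolding z(1) prod.case using de by simp
    next
      fix z :: "nat \<times> nat" assume "z \<in> UNIV \<times> UNIV"
      obtain m d where z: "z = (m, d)"
        by (cases z)
      have S: "Suc (Suc m * Suc d - 1) = Suc m * Suc d"
        by simp
      show "(\<lambda>(n, d). (Suc n div d - 1, d - 1)) ((\<lambda>(m, d). (Suc m * Suc d - 1, Suc d)) z) = z"
        unfolding z prod.case S by (simp del: mult_Suc mult_Suc_right)
      show "(\<lambda>(m, d). (Suc m * Suc d - 1, Suc d)) z \<in> Sigma UNIV (\<lambda>n. {d. d dvd Suc n})"
        unfolding z prod.case using S by (metis UNIV_I SigmaI dvd_triv_right mem_Collect_eq)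
      show "U ((\<lambda>(m, d). (Suc m * Suc d - 1, Suc d)) z) = T z"
        unfolding z prod.case U_def T_def S ..
    qed auto
    with T show ?thesis by simp
  qed
  hence 2: "((\<lambda>n. \<Sum>d | d dvd Suc n. U (n, d)) has_sum s) UNIV"
    by (rule has_sum_SigmaD) (auto intro: has_sum_finiteI)
  have "(\<Sum>d | d dvd Suc n. U (n, d)) = of_int (sigma_star (Suc k) (Suc n)) * q ^ Suc n / fact k" for n
    by (simp add: U_def sigma_star_def sum_negf sum_distrib_left sum_divide_distrib mult_ac
             del: power_Suc)
  hence "(\<lambda>n. of_int (sigma_star (Suc k) (Suc n)) * q ^ Suc n / fact k) sums s"
    using has_sum_imp_sums[OF 2] by simp
  hence "(\<lambda>n. fact k * (of_int (sigma_star (Suc k) (Suc n)) * q ^ Suc n / fact k)) sums (fact k * s)"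
    by (rule sums_mult)
  hence "(\<Sum>n. of_int (sigma_star (Suc k) (Suc n)) * q ^ Suc n) = fact k * s"
    by (simp add: sums_iff)
  with 1 show ?thesis by simp
qed

text \<open>The index m = 0 gives the constant term; for even k, reflection makes the negative
  indices contribute the same as the positive ones.\<close>

lemma lattice_sum_even:
  assumes "even k"
  shows "lattice_sum q k = gfps 1 $ k + 2 * (\<Sum>n. of_int (sigma_star (Suc k) (Suc n)) * q ^ Suc n) / fact k"
proof -
  define s where "s = (\<Sum>n. of_int (sigma_star (Suc k) (Suc n)) * q ^ Suc n) / fact k"
  have pos: "((\<lambda>m::int. gfps (q powi m) $ k) has_sum s) {0<..}"
    using gfps_power_suminf_sigma_star[of k] unfolding s_def
    by (subst has_sum_reindex_bij_witness[where T = UNIV and i = "\<lambda>n. int (Suc n)" and j = "\<lambda>m. nat m - 1"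
          and h = "\<lambda>m::nat. gfps (q ^ Suc m) $ k"])
       (auto simp: power_int_def Suc_diff_Suc simp del: power_Suc)
  have neg: "((\<lambda>m::int. gfps (q powi m) $ k) has_sum s) {..<0}"
    using pos assms gfps_power_int_minus[of _ k]
    by (subst has_sum_reindex_bij_witness[where T = "{0<..}" and i = uminus and j = uminus
          and h = "\<lambda>m::int. gfps (q powi m) $ k"]) auto
  have "((\<lambda>m::int. gfps (q powi m) $ k) has_sum gfps 1 $ k) {0}"
    by (rule has_sum_finiteI) auto
  hence "((\<lambda>m::int. gfps (q powi m) $ k) has_sum (gfps 1 $ k + s + s)) ({0} \<union> {0<..} \<union> {..<0})"
    by (intro has_sum_Un_disjoint pos neg) auto
  also have "{0} \<union> {0<..} \<union> {..<0} = (UNIV :: int set)"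
    by auto
  finally show ?thesis
    by (simp add: lattice_sum_def infsumI s_def)
qed

end

section \<open>Positivity\<close>

lemma sum_even_convolution:
  fixes f :: "nat \<Rightarrow> 'a::comm_semiring_1"
  assumes "\<And>k. odd k \<Longrightarrow> f k = 0"
  shows "(\<Sum>i=0..2*j. f i * f (2 * j - i)) = (\<Sum>i=0..j. f (2 * i) * f (2 * (j - i)))"
proof -
  have "(\<Sum>i=0..2*j. f i * f (2 * j - i)) = (\<Sum>i\<in>(\<lambda>i. 2 * i) ` {0..j}. f i * f (2 * j - i))"
  proof (rule sum.mono_neutral_right)
    show "\<forall>i\<in>{0..2*j} - (\<lambda>i. 2 * i) ` {0..j}. f i * f (2 * j - i) = 0"
    proof
      fix i assume i: "i \<in> {0..2*j} - (\<lambda>i. 2 * i) ` {0..j}"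
      have "odd i"
      proof
        assume "even i"
        then obtain l where "i = 2 * l"
          by (elim evenE)
        with i show False by auto
      qed
      thus "f i * f (2 * j - i) = 0"
        by (simp add: assms)
    qed
  qed auto
  also have "\<dots> = (\<Sum>i=0..j. f (2 * i) * f (2 * (j - i)))"
    by (subst sum.reindex) (auto simp: inj_on_def right_diff_distrib')
  finally show ?thesis .
qed

text \<open>The sign (-1)^j factors as (-1)^i (-1)^(j-i) through the convolution, while the left
  side gains one more factor -1, so -6 becomes +6. The end terms i = 0 and i = j contain
  \<open>a 0\<close> and join the linear term.\<close>

lemma alternating_rec:
  fixes f :: "nat \<Rightarrow> 'a::field_char_0"
  assumes odd: "\<And>k. odd k \<Longrightarrow> f k = 0"
    and rec: "of_nat ((2 * j + 2) * (2 * j + 1)) * f (2 * j + 2) =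
      c * f (2 * j) - 6 * (\<Sum>i=0..2*j. f i * f (2 * j - i))"
    and a: "\<And>i. a i = (-1) ^ i * f (2 * i)"
    and j: "j \<ge> 1"
  shows "of_nat ((2 * j + 2) * (2 * j + 1)) * a (Suc j) =
      (12 * a 0 - c) * a j + 6 * (\<Sum>i=1..<j. a i * a (j - i))"
proof -
  have split: "{0..j} = insert 0 (insert j {1..<j})"
    using j by auto
  have even: "(\<Sum>i=0..2*j. f i * f (2 * j - i)) = (\<Sum>i=0..j. f (2 * i) * f (2 * (j - i)))"
    using odd by (rule sum_even_convolution)
  have "(-1) ^ j * (\<Sum>i=0..2*j. f i * f (2 * j - i)) = (\<Sum>i=0..j. a i * a (j - i))"
    unfolding even sum_distrib_left
  proof (rule sum.cong[OF refl])
    fix i assume "i \<in> {0..j}"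
    hence "(-1) ^ j = (-1) ^ i * ((-1) ^ (j - i) :: 'a)"
      by (simp flip: power_add)
    thus "(-1) ^ j * (f (2 * i) * f (2 * (j - i))) = a i * a (j - i)"
      by (simp add: a)
  qed
  also have "\<dots> = 2 * a 0 * a j + (\<Sum>i=1..<j. a i * a (j - i))"
    using j unfolding split by (subst sum.insert, simp, simp)+ (simp add: algebra_simps)
  finally have conv: "(-1) ^ j * (\<Sum>i=0..2*j. f i * f (2 * j - i)) =
    2 * a 0 * a j + (\<Sum>i=1..<j. a i * a (j - i))" .
  have "of_nat ((2 * j + 2) * (2 * j + 1)) * a (Suc j) =
      - ((-1) ^ j * (of_nat ((2 * j + 2) * (2 * j + 1)) * f (2 * j + 2)))"
    by (simp add: a)
  also have "\<dots> = - c * a j + 6 * ((-1) ^ j * (\<Sum>i=0..2*j. f i * f (2 * j - i)))"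
    unfolding rec by (simp add: a algebra_simps)
  also have "\<dots> = (12 * a 0 - c) * a j + 6 * (\<Sum>i=1..<j. a i * a (j - i))"
    unfolding conv by (simp add: algebra_simps)
  finally show ?thesis .
qed

section \<open>Constant terms and their signs\<close>

text \<open>The constant term in the q-expansion of \<open>(-1) ^ j * lattice_sum q (2 * j)\<close>,
  by \<open>gfps_1_bernoulli\<close> a nonzero rational multiple of
  \<open>bernoulli (2 * Suc j)\<close>.\<close>

definition cusp_coeff :: "nat \<Rightarrow> rat" where
  "cusp_coeff j = (-1) ^ j * gfps 1 $ (2 * j)"

lemma gfps_1_odd: "odd k \<Longrightarrow> gfps (1::'a::field_char_0) $ k = 0"
  using gfps_inverse[of "1::'a" k] by simp

lemma gfps_1_nth_0: "gfps (1::'a::field_char_0) $ 0 = 1 / 4"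
  by (simp add: gfps_def hfps_def)

text \<open>\<open>gfps 1\<close> satisfies the recurrence with c = 1, and
  \<open>cusp_coeff 0\<close> is 1/4, so the linear factor 12/4 - 1 = 2 is positive. The start j = 1
  has value 1/16, from \<open>gfps_rec\<close> at k = 0.\<close>

lemma cusp_coeff_pos: "j \<ge> 1 \<Longrightarrow> cusp_coeff j > 0"
proof (induction j rule: less_induct)
  case (less j)
  show ?case
  proof (cases "j = 1")
    case True
    have "2 * gfps (1::rat) $ 2 = - 1 / 8"
      using gfps_rec[of "1::rat" 0] by (simp add: gfps_1_nth_0 power2_eq_square numeral_2_eq_2)
    thus ?thesis
      using True by (simp add: cusp_coeff_def)
  next
    case False
    then obtain i where i: "j = Suc i" "i \<ge> 1"
      using less.prems by (cases j) auto
    have "rat_of_nat ((2 * i + 2) * (2 * i + 1)) * cusp_coeff (Suc i) =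
        (12 * cusp_coeff 0 - 1) * cusp_coeff i + 6 * (\<Sum>l=1..<i. cusp_coeff l * cusp_coeff (i - l))"
    proof (rule alternating_rec[OF _ _ cusp_coeff_def i(2)])
      show "rat_of_nat ((2 * i + 2) * (2 * i + 1)) * gfps 1 $ (2 * i + 2) =
          1 * gfps 1 $ (2 * i) - 6 * (\<Sum>l=0..2*i. gfps 1 $ l * gfps 1 $ (2 * i - l))"
        using gfps_rec[of "1::rat" "2 * i"] by (simp add: power2_eq_square fps_mult_nth)
    qed (rule gfps_1_odd)
    moreover have "12 * cusp_coeff 0 - 1 = 2"
      by (simp add: cusp_coeff_def gfps_1_nth_0)
    moreover have "cusp_coeff i > 0"
      using less.IH[of i] i by simp
    moreover have "(\<Sum>l=1..<i. cusp_coeff l * cusp_coeff (i - l)) \<ge> 0"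
      using i by (intro sum_nonneg mult_nonneg_nonneg less_imp_le[OF less.IH]) auto
    ultimately have "rat_of_nat ((2 * i + 2) * (2 * i + 1)) * cusp_coeff (Suc i) > 0"
      by (simp only: add_pos_nonneg mult_pos_pos mult_nonneg_nonneg zero_less_numeral zero_le_numeral)
    thus ?thesis
      unfolding i(1) by (rule zero_less_mult_pos) (simp only: of_nat_0_less_iff, simp)
  qed
qed

lemma q_param_bounds:
  assumes "\<tau> \<in> upper_half_plane"
  shows "q_param \<tau> \<noteq> 0" "norm (q_param \<tau>) < 1"
  using assms by (auto simp: q_param_def upper_half_plane_def)

text \<open>Factoring the constant term out of \<open>lattice_sum_even\<close> leaves exactly the
  normalisation of \<open>E_star\<close>.\<close>

lemma lattice_sum_E_star:
  assumes "\<tau> \<in> upper_half_plane" "j \<ge> 1"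
  shows "(-1) ^ j * lattice_sum (q_param \<tau>) (2 * j) = of_rat (cusp_coeff j) * E_star (Suc j) \<tau>"
proof -
  define S where "S = (\<Sum>n. of_int (sigma_star (Suc (2 * j)) (Suc n)) * q_param \<tau> ^ Suc n)"
  define b :: complex where "b = of_rat (bernoulli (2 * Suc j))"
  define p :: complex where "p = 2 ^ (2 * Suc j)"
  define n :: complex where "n = of_nat (Suc j)"
  \<comment> \<open>The positive constant term shows that \<open>E_star\<close> does not divide by
    zero here.\<close>
  have "bernoulli (2 * Suc j) \<noteq> 0"
    using cusp_coeff_pos[OF assms(2)] unfolding cusp_coeff_def gfps_1_bernoulli by auto
  hence b: "b \<noteq> 0"
    by (simp add: b_def)
  have p: "p - 1 \<noteq> 0"
  proof
    assume "p - 1 = 0"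
    hence "(of_nat (2 ^ (2 * Suc j)) :: complex) = of_nat 1"
      by (simp add: p_def)
    hence "2 ^ (2 * Suc j) = (1::nat)"
      by (subst (asm) of_nat_eq_iff)
    thus False by simp
  qed
  have n: "n \<noteq> 0"
    unfolding n_def by (rule of_nat_neq_0)
  have fct: "of_rat (fact n) = (fact n :: complex)" for n
    by (metis of_nat_fact of_rat_of_nat_eq)
  have g: "gfps (1::complex) $ (2 * j) = (p - 1) * b / (2 * n * fact (2 * j))"
    by (subst gfps_1_of_rat, subst gfps_1_bernoulli)
       (simp add: of_rat_divide of_rat_mult of_rat_diff of_rat_power of_rat_add fct b_def p_def n_def)
  have E: "E_star (Suc j) \<tau> = 1 + 1 / (p - 1) * (4 * n / b) * S"
  proof -
    have "1 / (1 - p) = - (1 / (p - 1))"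
      using p by (metis minus_diff_eq minus_divide_right)
    thus ?thesis
      unfolding E_star_def S_def p_def b_def n_def by simp
  qed
  have "lattice_sum (q_param \<tau>) (2 * j) = gfps 1 $ (2 * j) + 2 * S / fact (2 * j)"
    unfolding S_def by (rule lattice_sum_even[OF q_param_bounds[OF assms(1)]]) simp
  also have "\<dots> = gfps 1 $ (2 * j) * E_star (Suc j) \<tau>"
    unfolding E g using b p n by (simp add: divide_simps)
  finally show ?thesis
    by (simp add: cusp_coeff_def of_rat_mult of_rat_power of_rat_minus flip: gfps_1_of_rat)
qed

text \<open>\<open>L\<close> absorbs both the constant c and the weight two term \<open>a 0\<close>.
  It depends on \<open>\<tau>\<close> but not on j, so a single case can determine its
  effect.\<close>

lemma E_star_rec:
  assumes "\<tau> \<in> upper_half_plane"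
  obtains L where "\<And>j. j \<ge> 1 \<Longrightarrow>
    of_nat ((2 * j + 2) * (2 * j + 1)) * (of_rat (cusp_coeff (Suc j)) * E_star (Suc (Suc j)) \<tau>) =
      L * (of_rat (cusp_coeff j) * E_star (Suc j) \<tau>) +
      6 * (\<Sum>i=1..<j. of_rat (cusp_coeff i) * E_star (Suc i) \<tau> *
             (of_rat (cusp_coeff (j - i)) * E_star (Suc (j - i)) \<tau>))"
proof -
  note q = q_param_bounds[OF assms]
  obtain c where c: "\<And>k. k \<ge> 1 \<Longrightarrow> of_nat ((k + 2) * (k + 1)) * lattice_sum (q_param \<tau>) (k + 2) =
    c * lattice_sum (q_param \<tau>) k - 6 * (\<Sum>i=0..k. lattice_sum (q_param \<tau>) i * lattice_sum (q_param \<tau>) (k - i))"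
    using lattice_sum_rec[OF q] by blast
  define a where "a = (\<lambda>i. (-1) ^ i * lattice_sum (q_param \<tau>) (2 * i))"
  show ?thesis
  proof (rule that)
    fix j :: nat assume j: "j \<ge> 1"
    have aE: "a i = of_rat (cusp_coeff i) * E_star (Suc i) \<tau>" if "i \<ge> 1" for i
      unfolding a_def using assms that by (rule lattice_sum_E_star)
    have "of_nat ((2 * j + 2) * (2 * j + 1)) * a (Suc j) =
        (12 * a 0 - c) * a j + 6 * (\<Sum>i=1..<j. a i * a (j - i))"
      by (rule alternating_rec[OF lattice_sum_odd[OF q] c _ j]) (use j in \<open>auto simp: a_def\<close>)
    also have "(\<Sum>i=1..<j. a i * a (j - i)) = (\<Sum>i=1..<j. of_rat (cusp_coeff i) * E_star (Suc i) \<tau> *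
             (of_rat (cusp_coeff (j - i)) * E_star (Suc (j - i)) \<tau>))"
      by (intro sum.cong) (auto simp: aE)
    finally show "of_nat ((2 * j + 2) * (2 * j + 1)) * (of_rat (cusp_coeff (Suc j)) * E_star (Suc (Suc j)) \<tau>) =
      (12 * a 0 - c) * (of_rat (cusp_coeff j) * E_star (Suc j) \<tau>) +
      6 * (\<Sum>i=1..<j. of_rat (cusp_coeff i) * E_star (Suc i) \<tau> *
             (of_rat (cusp_coeff (j - i)) * E_star (Suc (j - i)) \<tau>))"
      using j by (simp only: aE[OF j] aE[of "Suc j"])
  qed
qed

section \<open>Rational polynomials evaluated at B and C\<close>

lemma poly_map_of_rat_add:
  "poly (map_poly of_rat (p + q)) y = poly (map_poly of_rat p) y + poly (map_poly of_rat q) (y :: complex)"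
  by (induction p q rule: poly_induct2) (simp_all add: map_poly_pCons of_rat_add algebra_simps)

lemma poly_map_of_rat_smult:
  "poly (map_poly of_rat (smult c p)) y = of_rat c * poly (map_poly of_rat p) (y :: complex)"
  by (induction p) (simp_all add: map_poly_pCons of_rat_mult algebra_simps)

lemma poly_map_of_rat_mult:
  "poly (map_poly of_rat (p * q)) y = poly (map_poly of_rat p) y * poly (map_poly of_rat q) (y :: complex)"
  by (induction p)
     (simp_all add: map_poly_pCons poly_map_of_rat_add poly_map_of_rat_smult algebra_simps)

lemma eval2_0 [simp]: "eval2 0 x y = 0"
  by (simp add: eval2_def)

lemma eval2_pCons [simp]: "eval2 (pCons p P) x y = poly (map_poly of_rat p) y + x * eval2 P x y"
  by (simp add: eval2_def map_poly_pCons)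

lemma eval2_add: "eval2 (P + Q) x y = eval2 P x y + eval2 Q x y"
  by (induction P Q rule: poly_induct2) (simp_all add: poly_map_of_rat_add algebra_simps)

lemma eval2_smult: "eval2 (smult p P) x y = poly (map_poly of_rat p) y * eval2 P x y"
  by (induction P) (simp_all add: poly_map_of_rat_mult algebra_simps)

lemma eval2_mult: "eval2 (P * Q) x y = eval2 P x y * eval2 Q x y"
  by (induction P) (simp_all add: eval2_add eval2_smult algebra_simps)

text \<open>In this form the condition is visibly stable under sums and products.\<close>

lemma positive_coeffs_iff: "positive_coeffs P \<longleftrightarrow> (\<forall>i j. coeff (coeff P i) j \<ge> 0)"
  unfolding positive_coeffs_def by (metis less_eq_rat_def)

text \<open>A semiring of functions, considered only through their values on the upper half-plane;
  its closure rules replace explicit polynomials in the induction.\<close>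

definition positive_BC :: "(complex \<Rightarrow> complex) set" where
  "positive_BC = {f. \<exists>P. positive_coeffs P \<and> (\<forall>\<tau>\<in>upper_half_plane. f \<tau> = eval2 P (B_form \<tau>) (C_form \<tau>))}"

lemma positive_BCI:
  assumes "positive_coeffs P" "\<And>\<tau>. \<tau> \<in> upper_half_plane \<Longrightarrow> f \<tau> = eval2 P (B_form \<tau>) (C_form \<tau>)"
  shows "f \<in> positive_BC"
  using assms by (auto simp: positive_BC_def)

lemma positive_BC_const: "c \<ge> 0 \<Longrightarrow> (\<lambda>_. of_rat c) \<in> positive_BC"
  by (rule positive_BCI[of "[:[:c:]:]"]) (auto simp: positive_coeffs_iff coeff_pCons map_poly_pCons split: nat.split)

lemma positive_BC_B: "B_form \<in> positive_BC"
  by (rule positive_BCI[of "[:0, 1:]"])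
     (auto simp: positive_coeffs_iff coeff_pCons map_poly_pCons one_pCons split: nat.split)

lemma positive_BC_C: "C_form \<in> positive_BC"
  by (rule positive_BCI[of "[:[:0, 1:]:]"])
     (auto simp: positive_coeffs_iff coeff_pCons map_poly_pCons one_pCons split: nat.split)

lemma positive_BC_add:
  assumes "f \<in> positive_BC" "g \<in> positive_BC"
  shows "(\<lambda>\<tau>. f \<tau> + g \<tau>) \<in> positive_BC"
proof -
  obtain P Q where "positive_coeffs P" "positive_coeffs Q"
    "\<forall>\<tau>\<in>upper_half_plane. f \<tau> = eval2 P (B_form \<tau>) (C_form \<tau>)"
    "\<forall>\<tau>\<in>upper_half_plane. g \<tau> = eval2 Q (B_form \<tau>) (C_form \<tau>)"
    using assms unfolding positive_BC_def by blast
  thus ?thesis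
    by (intro positive_BCI[of "P + Q"]) (auto simp: positive_coeffs_iff eval2_add)
qed

lemma positive_BC_mult:
  assumes "f \<in> positive_BC" "g \<in> positive_BC"
  shows "(\<lambda>\<tau>. f \<tau> * g \<tau>) \<in> positive_BC"
proof -
  obtain P Q where "positive_coeffs P" "positive_coeffs Q"
    "\<forall>\<tau>\<in>upper_half_plane. f \<tau> = eval2 P (B_form \<tau>) (C_form \<tau>)"
    "\<forall>\<tau>\<in>upper_half_plane. g \<tau> = eval2 Q (B_form \<tau>) (C_form \<tau>)"
    using assms unfolding positive_BC_def by blast
  thus ?thesis
    by (intro positive_BCI[of "P * Q"])
       (auto simp: positive_coeffs_iff eval2_mult coeff_mult coeff_sum intro!: sum_nonneg)
qed

lemma positive_BC_sum:
  assumes "\<And>i. i \<in> I \<Longrightarrow> f i \<in> positive_BC"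
  shows "(\<lambda>\<tau>. \<Sum>i\<in>I. f i \<tau>) \<in> positive_BC"
  using assms positive_BC_const[of 0]
  by (induction I rule: infinite_finite_induct) (auto intro!: positive_BC_add)

text \<open>Induction along \<open>E_star_rec\<close>. Each earlier series has a factor B: in the
  linear term it turns \<open>L\<close> into a positive multiple of B C, and each product of two
  series keeps a spare B after one is taken out.\<close>

lemma E_star_in_B_positive_BC:
  assumes "j \<ge> 1"
  shows "\<exists>g\<in>positive_BC. \<forall>\<tau>\<in>upper_half_plane. E_star (Suc j) \<tau> = B_form \<tau> * g \<tau>"
  using assms
proof (induction j rule: less_induct)
  case (less j)
  show ?case
  proof (cases "j = 1")
    case True
    show ?thesis
      using positive_BC_const[of 1]
      by (intro bexI[of _ "\<lambda>_. 1"]) (auto simp: True B_form_def numeral_2_eq_2)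
  next
    case False
    then obtain i where i: "j = Suc i" "i \<ge> 1"
      using less.prems by (cases j) auto
    have "\<forall>l\<in>{1..i}. \<exists>g. g \<in> positive_BC \<and> (\<forall>\<tau>\<in>upper_half_plane. E_star (Suc l) \<tau> = B_form \<tau> * g \<tau>)"
      unfolding Bex_def[symmetric] using i by (intro ballI less.IH) auto
    from bchoice[OF this] obtain g where g: "\<And>l. l \<in> {1..i} \<Longrightarrow> g l \<in> positive_BC"
      "\<And>l \<tau>. l \<in> {1..i} \<Longrightarrow> \<tau> \<in> upper_half_plane \<Longrightarrow> E_star (Suc l) \<tau> = B_form \<tau> * g l \<tau>"
      by blast
    note pos = cusp_coeff_pos[THEN less_imp_le]
    define N where "N = rat_of_nat ((2 * i + 2) * (2 * i + 1)) * cusp_coeff (Suc i)"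
    have N: "N > 0"
      unfolding N_def by (intro mult_pos_pos cusp_coeff_pos) (simp_all only: of_nat_0_less_iff, simp_all)
    \<comment> \<open>The right side of the recurrence divided by \<open>N\<close> and by one factor
      B, with \<open>L * B\<close> replaced according to \<open>LB\<close> below.\<close>
    define h where "h = (\<lambda>\<tau>. of_rat (1 / N) *
      (of_rat (12 * cusp_coeff 2 / cusp_coeff 1 * cusp_coeff i) * (C_form \<tau> * g i \<tau>) +
       of_rat 6 * (\<Sum>l=1..<i. of_rat (cusp_coeff l * cusp_coeff (i - l)) * (B_form \<tau> * (g l \<tau> * g (i - l) \<tau>)))))"
    have "h \<in> positive_BC"
      unfolding h_def
      by (intro positive_BC_mult positive_BC_add positive_BC_sum positive_BC_const positive_BC_C positive_BC_B g)
         (use i N in \<open>auto intro!: divide_nonneg_nonneg mult_nonneg_nonneg pos\<close>)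
    moreover have "E_star (Suc j) \<tau> = B_form \<tau> * h \<tau>" if \<tau>: "\<tau> \<in> upper_half_plane" for \<tau>
    proof -
      obtain L where L: "\<And>j. j \<ge> 1 \<Longrightarrow>
        of_nat ((2 * j + 2) * (2 * j + 1)) * (of_rat (cusp_coeff (Suc j)) * E_star (Suc (Suc j)) \<tau>) =
          L * (of_rat (cusp_coeff j) * E_star (Suc j) \<tau>) +
          6 * (\<Sum>i=1..<j. of_rat (cusp_coeff i) * E_star (Suc i) \<tau> *
                 (of_rat (cusp_coeff (j - i)) * E_star (Suc (j - i)) \<tau>))"
        using E_star_rec[OF \<tau>] by blast
      have c1: "of_rat (cusp_coeff 1) \<noteq> (0::complex)" and c2: "of_rat (cusp_coeff 2) \<noteq> (0::complex)"
        using cusp_coeff_pos[of 1] cusp_coeff_pos[of 2] by auto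
      \<comment> \<open>For j = 1 the convolution is empty and the factor is 4 * 3 = 12. This fixes
        \<open>L * B_form \<tau>\<close> without dividing by B, so zeros of B do no harm.\<close>
      have L1: "12 * (of_rat (cusp_coeff 2) * E_star 3 \<tau>) = L * (of_rat (cusp_coeff 1) * B_form \<tau>)"
        using L[of 1] by (simp add: B_form_def numeral_2_eq_2 numeral_3_eq_3)
      \<comment> \<open>This holds even where \<open>B\<close> vanishes and \<open>C\<close> is the junk value \<open>0\<close>.\<close>
      have E3: "E_star 3 \<tau> = B_form \<tau> * C_form \<tau>"
        using L1 c2 by (cases "B_form \<tau> = 0") (auto simp: C_form_def B_form_def)
      have LB: "L * B_form \<tau> = of_rat (12 * cusp_coeff 2 / cusp_coeff 1) * (B_form \<tau> * C_form \<tau>)"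
        using L1 c1 unfolding E3 by (auto simp: of_rat_mult of_rat_divide field_simps)
      have "of_rat N * E_star (Suc j) \<tau> =
          L * (of_rat (cusp_coeff i) * E_star (Suc i) \<tau>) +
          6 * (\<Sum>l=1..<i. of_rat (cusp_coeff l) * E_star (Suc l) \<tau> *
                 (of_rat (cusp_coeff (i - l)) * E_star (Suc (i - l)) \<tau>))"
        using L[OF i(2)] by (simp only: N_def i of_rat_mult of_rat_of_nat_eq mult.assoc)
      also have "L * (of_rat (cusp_coeff i) * E_star (Suc i) \<tau>) = L * B_form \<tau> * (of_rat (cusp_coeff i) * g i \<tau>)"
        using i by (simp add: g(2)[OF _ \<tau>])
      also have "\<dots> = B_form \<tau> * (of_rat (12 * cusp_coeff 2 / cusp_coeff 1 * cusp_coeff i) * (C_form \<tau> * g i \<tau>))"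
        unfolding LB of_rat_mult by (simp only: mult_ac)
      also have "(\<Sum>l=1..<i. of_rat (cusp_coeff l) * E_star (Suc l) \<tau> *
                 (of_rat (cusp_coeff (i - l)) * E_star (Suc (i - l)) \<tau>)) =
          (\<Sum>l=1..<i. B_form \<tau> * (of_rat (cusp_coeff l * cusp_coeff (i - l)) * (B_form \<tau> * (g l \<tau> * g (i - l) \<tau>))))"
        by (intro sum.cong) (auto simp: g(2)[OF _ \<tau>] of_rat_mult mult_ac)
      also have "\<dots> = B_form \<tau> * (\<Sum>l=1..<i. of_rat (cusp_coeff l * cusp_coeff (i - l)) * (B_form \<tau> * (g l \<tau> * g (i - l) \<tau>)))"
        by (rule sum_distrib_left[symmetric])
      finally have "of_rat N * E_star (Suc j) \<tau> = of_rat N * (B_form \<tau> * h \<tau>)"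
        using N by (simp add: h_def of_rat_divide algebra_simps)
      thus ?thesis
        using N by simp
    qed
    ultimately show ?thesis by blast
  qed
qed

theorem theorem4p9:
  fixes m :: nat
  assumes "m \<ge> 2"
  shows "\<exists>P :: rat poly poly. positive_coeffs P \<and>
           (\<forall>\<tau>\<in>upper_half_plane.
              E_star m \<tau> = B_form \<tau> * eval2 P (B_form \<tau>) (C_form \<tau>))"
proof -
  obtain j where j: "m = Suc j" "j \<ge> 1"
    using assms by (cases m) auto
  show ?thesis
    using E_star_in_B_positive_BC[OF j(2)] unfolding j(1) positive_BC_def by auto
qed

end
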